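(* Let $D=(P_1,\dots,P_n)$ be a sequence of $n$ distinct points $P_i=(\alpha_i,\beta_i)\in\mathbb N\times\mathbb N$, put $s_i=\alpha_i+\beta_i$ for $1\le i\le n$, and assume $s_1\le s_2\le\cdots\le s_n$. Put $d=\sum_{i=1}^n s_i$ and $s_{n+1}=n$. Suppose $h,\ell,m$ are positive integers satisfying $2\le h<h+\ell+m\le n+1$, $s_h=h-1$, $s_{h+\ell}=h+\ell-1$, $s_{h+\ell+m}=h+\ell+m-1$ (the last condition holds automatically if $h+\ell+m=n+1$), and suppose that $\alpha_{h+\ell},\dots,\alpha_{h+\ell+m-1}\ge\ell$. Define the sequence $$\begin{aligned}D'=(&P_1,P_2,\dots,P_{h-1},\ P_{h+\ell}-(\ell,0),\,P_{h+\ell+1}-(\ell,0),\dots,P_{h+\ell+m-1}-(\ell,0),\\ &P_h+(m,0),\,P_{h+1}+(m,0),\dots,P_{h+\ell-1}+(m,0),\ P_{h+\ell+m},\dots,P_n).\end{aligned}$$ Then $\Delta(D)\sim\Delta(D')$ modulo $I_{<d}$, that is, $\Delta(D)-\Delta(D')\in I_{<d}$.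
   Context: $\mathbb N$ is the set of nonnegative integers. $I=\bigcap_{1\le i<j\le n}(x_i-x_j,\,y_i-y_j)\subset\mathbb C[x_1,y_1,\dots,x_n,y_n]$, and $I_{<d}$ is the ideal of $\mathbb C[x_1,y_1,\dots,x_n,y_n]$ generated by the homogeneous elements of $I$ of degree less than $d$. For a sequence $D$ of $n$ points $(\alpha_1,\beta_1),\dots,(\alpha_n,\beta_n)$ of $\mathbb N\times\mathbb N$, $\Delta(D)=\det\big[x_i^{\alpha_j}y_i^{\beta_j}\big]_{1\le i,j\le n}$ (with columns in the order of the sequence; it is $0$ if two points coincide). *)

theory Defs
  imports
    "HOL-Library.Poly_Mapping"
    "HOL-Algebra.Ideal"
    "Jordan_Normal_Form.Determinant"
begin

datatype var = X nat | Y nat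

text \<open>Finitely supported exponent functions are monomials; finitely supported coefficient functions
  on monomials are polynomials, multiplied by convolution.\<close>

type_synonym monomial = "var \<Rightarrow>\<^sub>0 nat"
type_synonym cpoly = "monomial \<Rightarrow>\<^sub>0 complex"

definition var_poly :: "var \<Rightarrow> cpoly" where
  "var_poly v = Poly_Mapping.single (Poly_Mapping.single v 1) 1"

abbreviation x_var :: "nat \<Rightarrow> cpoly" where "x_var i \<equiv> var_poly (X i)"
abbreviation y_var :: "nat \<Rightarrow> cpoly" where "y_var i \<equiv> var_poly (Y i)"

text \<open>\<open>poly_ring n\<close> is $\mathbb{C}[x_1,y_1,\dots,x_n,y_n]$, carved out of the polynomials in all
  the variables so that \<open>n\<close> can be an ordinary parameter.\<close>

definition poly_ring :: "nat \<Rightarrow> cpoly ring" where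
  "poly_ring n =
     \<lparr>carrier = {p. \<forall>t \<in> Poly_Mapping.keys p. Poly_Mapping.keys t \<subseteq> X ` {1..n} \<union> Y ` {1..n}},
      monoid.mult = (*), one = 1, zero = 0, add = (+)\<rparr>"

lemma cring_poly_ring: "cring (poly_ring n)"
proof (rule cringI)
  let ?V = "X ` {1..n} \<union> Y ` {1..n}"
  let ?C = "{p :: cpoly. \<forall>t \<in> Poly_Mapping.keys p. Poly_Mapping.keys t \<subseteq> ?V}"
  have add: "p + q \<in> ?C" if "p \<in> ?C" "q \<in> ?C" for p q
    using that Poly_Mapping.keys_add[of p q] by fast
  have mult: "p * q \<in> ?C" if p: "p \<in> ?C" and q: "q \<in> ?C" for p q
  proof (clarify)
    fix t v
    assume t: "t \<in> Poly_Mapping.keys (p * q)" and v: "v \<in> Poly_Mapping.keys t" and "v \<notin> Y ` {1..n}"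
    from t obtain a b where "t = a + b" "a \<in> Poly_Mapping.keys p" "b \<in> Poly_Mapping.keys q"
      using keys_mult[of p q] by blast
    then show "v \<in> X ` {1..n}"
      using v p q \<open>v \<notin> Y ` {1..n}\<close> Poly_Mapping.keys_add[of a b] by blast
  qed
  have uminus: "- p \<in> ?C" if "p \<in> ?C" for p
    using that by simp
  show "abelian_group (poly_ring n)"
  proof (rule abelian_groupI)
    fix p assume "p \<in> carrier (poly_ring n)"
    then show "\<exists>q \<in> carrier (poly_ring n). q \<oplus>\<^bsub>poly_ring n\<^esub> p = \<zero>\<^bsub>poly_ring n\<^esub>"
      using uminus[of p] by (intro bexI[of _ "- p"]) (simp_all add: poly_ring_def)
  next
    fix p q assume "p \<in> carrier (poly_ring n)" "q \<in> carrier (poly_ring n)"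
    then show "p \<oplus>\<^bsub>poly_ring n\<^esub> q \<in> carrier (poly_ring n)"
      using add[of p q] by (simp add: poly_ring_def)
  qed (simp_all add: poly_ring_def ac_simps)
  show "Group.comm_monoid (poly_ring n)"
  proof (rule comm_monoidI)
    fix p q assume "p \<in> carrier (poly_ring n)" "q \<in> carrier (poly_ring n)"
    then show "p \<otimes>\<^bsub>poly_ring n\<^esub> q \<in> carrier (poly_ring n)"
      using mult[of p q] by (simp add: poly_ring_def)
  qed (simp_all add: poly_ring_def ac_simps)
qed (simp add: poly_ring_def distrib_right)

definition diag_ideal :: "nat \<Rightarrow> cpoly set" where
  "diag_ideal n = carrier (poly_ring n) \<inter>
     (\<Inter>i \<in> {1..n}. \<Inter>j \<in> {i<..n}. Idl\<^bsub>poly_ring n\<^esub> {x_var i - x_var j, y_var i - y_var j})"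

definition homogeneous :: "nat \<Rightarrow> cpoly \<Rightarrow> bool" where
  "homogeneous k p \<longleftrightarrow>
     (\<forall>t \<in> Poly_Mapping.keys p. (\<Sum>v \<in> Poly_Mapping.keys t. Poly_Mapping.lookup t v) = k)"

definition diag_ideal_below :: "nat \<Rightarrow> nat \<Rightarrow> cpoly set" where
  "diag_ideal_below n d =
     Idl\<^bsub>poly_ring n\<^esub> {p \<in> diag_ideal n. \<exists>k<d. homogeneous k p}"

text \<open>Matrix entries are indexed from \<open>0\<close>, variables from \<open>1\<close>.\<close>

definition Delta :: "(nat \<times> nat) list \<Rightarrow> cpoly" where
  "Delta D = det (mat (length D) (length D)
     (\<lambda>(i, j). x_var (Suc i) ^ fst (D ! j) * y_var (Suc i) ^ snd (D ! j)))"

end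

theory Submission
  imports Defs
begin

text \<open>
  Call a determinant whose $j$-th column is $f_j(x_i, y_i)$, for products
  $f_j = \prod_k (v_k - c_k)$ with each $v_k$ one of the coordinates $x, y$ and each $c_k$ a linear
  form that is the same in all rows, a column determinant. It vanishes whenever two rows (points)
  coincide, so it lies in $I$. Replacing one $c_k$ by $0$ changes the determinant by $c_k$ times a
  column determinant of degree $d - 1$, hence by an element of $I_{<d}$. So modulo $I_{<d}$ every
  column $x^\alpha y^\beta$ of $\Delta(D)$ may be replaced by a product with arbitrarily
  prescribed $c_k$ (\<open>column_det_cong_Delta\<close>); in particular it can be made to vanish in the first
  $\alpha + \beta$ rows, by taking for the $c_k$ the coordinates of these rows.

  The degree conditions $s_h = h - 1$, $s_{h+\ell} = h + \ell - 1$ and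
  $s_{h+\ell+m} = h + \ell + m - 1$ say that there are enough factors to make $\Delta(D)$
  block-triangular with respect to the four blocks $1..h-1$, $B = h..h+\ell-1$,
  $C = h+\ell..h+\ell+m-1$ and the rest. Since $\alpha_j \ge \ell$ for the points of $C$, their
  vanishing on the rows of $B$ can be achieved by the factor $\prod_{q \in B} (x - x_q)$ alone, so
  that the $C$ block contributes $\prod_{p \in C} \prod_{q \in B} (x_p - x_q)$ times the block that
  belongs to the points shifted by $-(\ell, 0)$. Let $E$ be $D'$ with its two middle blocks
  interchanged, so that each point is in the place where it was in $D$; then
  $\Delta(D') = (-1)^{\ell m} \Delta(E)$. Treat $E$ in the same way, but with $C$ ahead of $B$: its
  points over $B$ carry the additional factor $\prod_{q \in C} (x - x_q)$. The same diagonal blocks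
  appear, and the additional product is now $\prod_{p \in B} \prod_{q \in C} (x_p - x_q)$, which is
  $(-1)^{\ell m}$ times the previous one (\<open>det_block_exchange\<close>, \<open>prod_diff_swap\<close>). The two signs
  cancel.
\<close>

section \<open>The polynomial ring, its ideals and homogeneous polynomials\<close>

text \<open>The operations of \<open>poly_ring n\<close> are those of the ambient type, so closure properties of the
  carrier and of ideals can be used with type-class algebra.\<close>

lemma poly_ring_ops [simp]:
  "\<zero>\<^bsub>poly_ring n\<^esub> = 0" "\<one>\<^bsub>poly_ring n\<^esub> = 1"
  "p \<oplus>\<^bsub>poly_ring n\<^esub> q = p + q" "p \<otimes>\<^bsub>poly_ring n\<^esub> q = p * q"
  by (simp_all add: poly_ring_def)

interpretation poly_ring: cring "poly_ring n" for n
  by (rule cring_poly_ring)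

lemma poly_ring_uminus_closed: "p \<in> carrier (poly_ring n) \<Longrightarrow> - p \<in> carrier (poly_ring n)"
  by (simp add: poly_ring_def)

lemma poly_ring_diff_closed:
  "\<lbrakk>p \<in> carrier (poly_ring n); q \<in> carrier (poly_ring n)\<rbrakk> \<Longrightarrow> p - q \<in> carrier (poly_ring n)"
  using poly_ring.a_closed[of p n "- q"] poly_ring_uminus_closed[of q n] by simp

lemma poly_ring_mult_closed:
  "\<lbrakk>p \<in> carrier (poly_ring n); q \<in> carrier (poly_ring n)\<rbrakk> \<Longrightarrow> p * q \<in> carrier (poly_ring n)"
  using poly_ring.m_closed[of p n q] by simp

lemma poly_ring_sum_closed:
  "(\<And>i. i \<in> S \<Longrightarrow> f i \<in> carrier (poly_ring n)) \<Longrightarrow> sum f S \<in> carrier (poly_ring n)"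
  using poly_ring.zero_closed[of n] poly_ring.a_closed[of _ n]
  by (induction S rule: infinite_finite_induct) auto

lemma poly_ring_prod_closed:
  "(\<And>i. i \<in> S \<Longrightarrow> f i \<in> carrier (poly_ring n)) \<Longrightarrow> prod f S \<in> carrier (poly_ring n)"
  using poly_ring.one_closed[of n] poly_ring.m_closed[of _ n]
  by (induction S rule: infinite_finite_induct) auto

lemma x_var_closed: "\<lbrakk>Suc 0 \<le> i; i \<le> n\<rbrakk> \<Longrightarrow> x_var i \<in> carrier (poly_ring n)"
  by (auto simp: poly_ring_def var_poly_def)

lemma y_var_closed: "\<lbrakk>Suc 0 \<le> i; i \<le> n\<rbrakk> \<Longrightarrow> y_var i \<in> carrier (poly_ring n)"
  by (auto simp: poly_ring_def var_poly_def)

lemma signof_closed: "signof \<pi> \<in> carrier (poly_ring n)"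
  using poly_ring.one_closed[of n] poly_ring_uminus_closed[of 1 n]
  by (auto simp: sign_def)

lemma poly_ideal_zero: "ideal J (poly_ring n) \<Longrightarrow> 0 \<in> J"
  using additive_subgroup.zero_closed[OF ideal.axioms(1), of J "poly_ring n"] by simp

lemma poly_ideal_add: "\<lbrakk>ideal J (poly_ring n); p \<in> J; q \<in> J\<rbrakk> \<Longrightarrow> p + q \<in> J"
  using additive_subgroup.a_closed[OF ideal.axioms(1), of J "poly_ring n" p q] by simp

lemma poly_ideal_mult:
  "\<lbrakk>ideal J (poly_ring n); p \<in> J; q \<in> carrier (poly_ring n)\<rbrakk> \<Longrightarrow> q * p \<in> J"
  using ideal.I_l_closed[of J "poly_ring n" p q] by simp

lemma poly_ideal_uminus: "\<lbrakk>ideal J (poly_ring n); p \<in> J\<rbrakk> \<Longrightarrow> - p \<in> J"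
  using poly_ideal_mult[of J n p "- 1"] poly_ring_uminus_closed[of 1 n] poly_ring.one_closed[of n]
  by simp

lemma poly_ideal_diff: "\<lbrakk>ideal J (poly_ring n); p \<in> J; q \<in> J\<rbrakk> \<Longrightarrow> p - q \<in> J"
  using poly_ideal_add[of J n p "- q"] poly_ideal_uminus[of J n q] by simp

lemma poly_ideal_sum: "\<lbrakk>ideal J (poly_ring n); \<And>i. i \<in> S \<Longrightarrow> f i \<in> J\<rbrakk> \<Longrightarrow> sum f S \<in> J"
  by (induction S rule: infinite_finite_induct) (auto intro: poly_ideal_zero poly_ideal_add)

lemma homogeneous_zero [simp]: "homogeneous k 0"
  by (simp add: homogeneous_def)

lemma homogeneous_one: "homogeneous 0 1"
  by (simp add: homogeneous_def)

lemma homogeneous_var_poly: "homogeneous 1 (var_poly v)"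
  by (simp add: homogeneous_def var_poly_def)

lemma homogeneous_uminus: "homogeneous k p \<Longrightarrow> homogeneous k (- p)"
  by (simp add: homogeneous_def)

lemma homogeneous_add: "\<lbrakk>homogeneous k p; homogeneous k q\<rbrakk> \<Longrightarrow> homogeneous k (p + q)"
  unfolding homogeneous_def using Poly_Mapping.keys_add[of p q] by blast

lemma homogeneous_diff: "\<lbrakk>homogeneous k p; homogeneous k q\<rbrakk> \<Longrightarrow> homogeneous k (p - q)"
  using homogeneous_add[of k p "- q"] homogeneous_uminus[of k q] by simp

lemma homogeneous_mult:
  assumes "homogeneous j p" "homogeneous k q"
  shows "homogeneous (j + k) (p * q)"
  unfolding homogeneous_def
proof
  fix t assume "t \<in> Poly_Mapping.keys (p * q)"
  then obtain a b where t: "t = a + b" and ab: "a \<in> Poly_Mapping.keys p" "b \<in> Poly_Mapping.keys q"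
    using keys_mult[of p q] by blast
  let ?S = "Poly_Mapping.keys a \<union> Poly_Mapping.keys b"
  have *: "(\<Sum>v\<in>Poly_Mapping.keys u. Poly_Mapping.lookup u v) = (\<Sum>v\<in>?S. Poly_Mapping.lookup u v)"
    if "Poly_Mapping.keys u \<subseteq> ?S" for u :: monomial
    using that by (intro sum.mono_neutral_left) (auto simp: in_keys_iff)
  have "(\<Sum>v\<in>Poly_Mapping.keys t. Poly_Mapping.lookup t v)
      = (\<Sum>v\<in>?S. Poly_Mapping.lookup a v) + (\<Sum>v\<in>?S. Poly_Mapping.lookup b v)"
    using *[of t] Poly_Mapping.keys_add[of a b] by (simp add: t lookup_add sum.distrib)
  also have "\<dots> = j + k"
    using *[of a] *[of b] ab assms by (simp add: homogeneous_def)
  finally show "(\<Sum>v\<in>Poly_Mapping.keys t. Poly_Mapping.lookup t v) = j + k" .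
qed

lemma homogeneous_sum: "(\<And>i. i \<in> S \<Longrightarrow> homogeneous k (f i)) \<Longrightarrow> homogeneous k (sum f S)"
  by (induction S rule: infinite_finite_induct) (auto intro: homogeneous_add)

lemma homogeneous_prod:
  "(\<And>i. i \<in> S \<Longrightarrow> homogeneous (k i) (f i)) \<Longrightarrow> homogeneous (sum k S) (prod f S)"
  by (induction S rule: infinite_finite_induct) (auto intro: homogeneous_mult homogeneous_one)

lemma homogeneous_signof_mult: "homogeneous k p \<Longrightarrow> homogeneous k (signof \<pi> * p)"
  by (auto simp: sign_def homogeneous_uminus)

lemma ideal_diag_ideal_below: "ideal (diag_ideal_below n d) (poly_ring n)"
  unfolding diag_ideal_below_def
  by (rule poly_ring.genideal_ideal) (auto simp: diag_ideal_def)

lemma diag_ideal_belowI: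
  "\<lbrakk>p \<in> diag_ideal n; homogeneous k p; k < d\<rbrakk> \<Longrightarrow> p \<in> diag_ideal_below n d"
  unfolding diag_ideal_below_def
  by (rule subsetD[OF poly_ring.genideal_self]) (auto simp: diag_ideal_def)

section \<open>Determinants with columns that are products of linear forms\<close>

text \<open>A pair \<open>(v, c)\<close> with \<open>v\<close> one of \<open>X\<close>, \<open>Y\<close> is the factor that takes the value
  \<open>var_poly (v p) - c\<close> in the row of the \<open>p\<close>-th point.\<close>

definition column :: "((nat \<Rightarrow> var) \<times> cpoly) list \<Rightarrow> nat \<Rightarrow> cpoly" where
  "column fs p = (\<Prod>(v, c)\<leftarrow>fs. var_poly (v p) - c)"

lemma column_Nil [simp]: "column [] p = 1"
  and column_Cons [simp]: "column ((v, c) # fs) p = (var_poly (v p) - c) * column fs p"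
  and column_append [simp]: "column (fs @ gs) p = column fs p * column gs p"
  by (simp_all add: column_def)

lemma column_eq_0: "(v, c) \<in> set fs \<Longrightarrow> c = var_poly (v p) \<Longrightarrow> column fs p = 0"
  by (induction fs) auto

text \<open>The zero polynomial is homogeneous of degree $1$ too, so the plain coordinates are among the
  admissible factors.\<close>

definition admissible :: "nat \<Rightarrow> ((nat \<Rightarrow> var) \<times> cpoly) list \<Rightarrow> bool" where
  "admissible n fs \<longleftrightarrow>
     (\<forall>(v, c) \<in> set fs. (v = X \<or> v = Y) \<and> c \<in> carrier (poly_ring n) \<and> homogeneous 1 c)"

lemma admissible_Nil [simp]: "admissible n []"
  and admissible_Cons [simp]: "admissible n ((v, c) # fs) \<longleftrightarrow>
    (v = X \<or> v = Y) \<and> c \<in> carrier (poly_ring n) \<and> homogeneous 1 c \<and> admissible n fs"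
  and admissible_append [simp]: "admissible n (fs @ gs) \<longleftrightarrow> admissible n fs \<and> admissible n gs"
  by (auto simp: admissible_def)

lemma column_closed: "\<lbrakk>admissible n fs; p \<in> {1..n}\<rbrakk> \<Longrightarrow> column fs p \<in> carrier (poly_ring n)"
  using poly_ring.one_closed[of n]
  by (induction fs)
    (auto intro!: poly_ring_mult_closed poly_ring_diff_closed intro: x_var_closed y_var_closed)

lemma homogeneous_column: "admissible n fs \<Longrightarrow> homogeneous (length fs) (column fs p)"
proof (induction fs)
  case (Cons f fs)
  obtain v c where f: "f = (v, c)" by (cases f)
  have "homogeneous (1 + length fs) ((var_poly (v p) - c) * column fs p)"
    using Cons by (intro homogeneous_mult homogeneous_diff homogeneous_var_poly) (auto simp: f)
  then show ?case by (simp add: f)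
qed (simp add: homogeneous_one)

text \<open>A column has the form $f(x_p, y_p)$ with one polynomial $f$ for all rows $p$, and the values of
  $f$ at two congruent points are congruent.\<close>

lemma column_diff_in_ideal:
  assumes J: "ideal J (poly_ring n)" and pq: "p \<in> {1..n}" "q \<in> {1..n}"
    and x: "x_var p - x_var q \<in> J" and y: "y_var p - y_var q \<in> J"
    and fs: "admissible n fs"
  shows "column fs p - column fs q \<in> J"
  using fs
proof (induction fs)
  case Nil
  then show ?case using poly_ideal_zero[OF J] by simp
next
  case (Cons f fs)
  obtain v c where f: "f = (v, c)" by (cases f)
  have v: "v = X \<or> v = Y" and c: "c \<in> carrier (poly_ring n)" and fs: "admissible n fs"
    using Cons.prems by (auto simp: f)
  have "var_poly (v p) - c \<in> carrier (poly_ring n)"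
    using v c pq by (auto intro: poly_ring_diff_closed x_var_closed y_var_closed)
  then have "(var_poly (v p) - c) * (column fs p - column fs q) \<in> J"
    using Cons.IH[OF fs] by (rule poly_ideal_mult[OF J, rotated])
  moreover have "column fs q * (var_poly (v p) - var_poly (v q)) \<in> J"
    using v x y by (auto intro: poly_ideal_mult[OF J] column_closed[OF fs pq(2)])
  ultimately have "(var_poly (v p) - c) * (column fs p - column fs q)
      + column fs q * (var_poly (v p) - var_poly (v q)) \<in> J"
    by (rule poly_ideal_add[OF J])
  then show ?case by (simp add: f algebra_simps)
qed

definition column_det :: "nat \<Rightarrow> (nat \<Rightarrow> ((nat \<Rightarrow> var) \<times> cpoly) list) \<Rightarrow> cpoly" where
  "column_det n L = det (mat n n (\<lambda>(i, j). column (L j) (Suc i)))"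

lemma column_det_leibniz:
  "column_det n L = (\<Sum>\<pi> | \<pi> permutes {0..<n}. signof \<pi> * (\<Prod>i = 0..<n. column (L (\<pi> i)) (Suc i)))"
proof -
  have "\<pi> i < n" if "\<pi> permutes {0..<n}" "i < n" for \<pi> i
    using permutes_in_image[OF that(1), of i] that(2) by simp
  then show ?thesis
    unfolding column_det_def
    by (subst det_def'[of _ n]) (auto intro!: sum.cong prod.cong)
qed

lemma column_det_closed:
  assumes "\<And>j. j < n \<Longrightarrow> admissible n (L j)"
  shows "column_det n L \<in> carrier (poly_ring n)"
  unfolding column_det_leibniz
proof (rule poly_ring_sum_closed)
  fix \<pi> assume "\<pi> \<in> {\<pi>. \<pi> permutes {0..<n}}"
  then have "\<pi> i < n" if "i < n" for i
    using permutes_in_image[of \<pi> "{0..<n}" i] that by simp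
  then have "(\<Prod>i = 0..<n. column (L (\<pi> i)) (Suc i)) \<in> carrier (poly_ring n)"
    using assms by (auto intro!: poly_ring_prod_closed column_closed)
  then show "signof \<pi> * (\<Prod>i = 0..<n. column (L (\<pi> i)) (Suc i)) \<in> carrier (poly_ring n)"
    using poly_ring.m_closed[OF signof_closed] by simp
qed

lemma homogeneous_column_det:
  assumes "\<And>j. j < n \<Longrightarrow> admissible n (L j)"
  shows "homogeneous (\<Sum>j<n. length (L j)) (column_det n L)"
  unfolding column_det_leibniz
proof (intro homogeneous_sum homogeneous_signof_mult)
  fix \<pi> assume "\<pi> \<in> {\<pi>. \<pi> permutes {0..<n}}"
  then have \<pi>: "\<pi> permutes {0..<n}" by simp
  then have "\<pi> i < n" if "i < n" for i
    using permutes_in_image[of \<pi> "{0..<n}" i] that by simp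
  then have "homogeneous (\<Sum>i = 0..<n. length (L (\<pi> i))) (\<Prod>i = 0..<n. column (L (\<pi> i)) (Suc i))"
    using assms by (intro homogeneous_prod homogeneous_column[of n]) auto
  also have "(\<Sum>i = 0..<n. length (L (\<pi> i))) = (\<Sum>j<n. length (L j))"
    using sum.permute[OF \<pi>, of "\<lambda>j. length (L j)"] by (simp add: comp_def atLeast0LessThan)
  finally show "homogeneous (\<Sum>j<n. length (L j)) (\<Prod>i = 0..<n. column (L (\<pi> i)) (Suc i))" .
qed

text \<open>Subtracting row $q$ from row $p$ leaves the determinant unchanged and puts the whole row $p$
  into the ideal of the diagonal $\{p = q\}$.\<close>

lemma column_det_in_diag_ideal:
  assumes adm: "\<And>j. j < n \<Longrightarrow> admissible n (L j)"
  shows "column_det n L \<in> diag_ideal n"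
proof -
  have "column_det n L \<in> Idl\<^bsub>poly_ring n\<^esub> {x_var p - x_var q, y_var p - y_var q}"
    if p: "p \<in> {1..n}" and q: "q \<in> {p<..n}" for p q
  proof -
    let ?J = "Idl\<^bsub>poly_ring n\<^esub> {x_var p - x_var q, y_var p - y_var q}"
    have pq: "p \<in> {1..n}" "q \<in> {1..n}" "p \<noteq> q" using p q by auto
    have gens: "{x_var p - x_var q, y_var p - y_var q} \<subseteq> carrier (poly_ring n)"
      using pq by (auto intro: poly_ring_diff_closed x_var_closed y_var_closed)
    have J: "ideal ?J (poly_ring n)" by (rule poly_ring.genideal_ideal[OF gens])
    have xy: "x_var p - x_var q \<in> ?J" "y_var p - y_var q \<in> ?J"
      using poly_ring.genideal_self[OF gens] by auto
    let ?M = "mat n n (\<lambda>(i, j). column (L j) (Suc i))"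
    let ?N = "addrow (- 1) (p - 1) (q - 1) ?M"
    have "column_det n L = det ?N"
      unfolding column_det_def using pq by (intro det_addrow[symmetric, of _ n]) auto
    also have "\<dots> = (\<Sum>\<pi> | \<pi> permutes {0..<n}. signof \<pi> * (\<Prod>i = 0..<n. ?N $$ (i, \<pi> i)))"
      by (rule det_def') simp
    also have "\<dots> \<in> ?J"
    proof (rule poly_ideal_sum[OF J])
      fix \<pi> assume "\<pi> \<in> {\<pi>. \<pi> permutes {0..<n}}"
      then have \<pi>: "\<pi> i < n" if "i < n" for i
        using permutes_in_image[of \<pi> "{0..<n}" i] that by simp
      have "?N $$ (p - 1, \<pi> (p - 1))
          = column (L (\<pi> (p - 1))) p - column (L (\<pi> (p - 1))) q"
        using pq \<pi>[of "p - 1"] by auto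
      also have "\<dots> \<in> ?J"
        using pq \<pi>[of "p - 1"] adm by (intro column_diff_in_ideal[OF J _ _ xy]) auto
      finally have pivot: "?N $$ (p - 1, \<pi> (p - 1)) \<in> ?J" .
      have "(\<Prod>i\<in>{0..<n} - {p - 1}. ?N $$ (i, \<pi> i)) \<in> carrier (poly_ring n)"
        using \<pi> adm by (intro poly_ring_prod_closed) (auto intro: column_closed)
      then have "(\<Prod>i\<in>{0..<n} - {p - 1}. ?N $$ (i, \<pi> i)) * ?N $$ (p - 1, \<pi> (p - 1)) \<in> ?J"
        by (rule poly_ideal_mult[OF J pivot])
      also have "(\<Prod>i\<in>{0..<n} - {p - 1}. ?N $$ (i, \<pi> i)) * ?N $$ (p - 1, \<pi> (p - 1))
          = (\<Prod>i = 0..<n. ?N $$ (i, \<pi> i))"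
        using pq by (subst prod.remove[of "{0..<n}" "p - 1"]) (auto simp: mult.commute)
      finally show "signof \<pi> * (\<Prod>i = 0..<n. ?N $$ (i, \<pi> i)) \<in> ?J"
        by (intro poly_ideal_mult[OF J] signof_closed)
    qed
    finally show ?thesis .
  qed
  then show ?thesis
    using column_det_closed[OF adm] by (auto simp: diag_ideal_def)
qed

text \<open>Linearity in the column \<open>j\<close>; the constant \<open>c\<close> comes out of the determinant because it is the
  same in all rows.\<close>

lemma column_det_split_factor:
  assumes j: "j < n"
  shows "column_det n (L(j := fs @ (v, c) # gs))
       = column_det n (L(j := fs @ (v, 0) # gs)) - c * column_det n (L(j := fs @ gs))"
proof -
  define M where "M hs = mat n n (\<lambda>(i, k). column ((L(j := hs)) k) (Suc i))" for hs
  have cof: "cofactor (M hs) i j = cofactor (M []) i j" if "i < n" for hs i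
  proof -
    have "mat_delete (M hs) i j = mat_delete (M []) i j"
      unfolding mat_delete_def M_def using that j by (intro eq_matI) auto
    then show ?thesis by (simp add: cofactor_def)
  qed
  have expand: "column_det n (L(j := hs)) = (\<Sum>i<n. column hs (Suc i) * cofactor (M []) i j)" for hs
  proof -
    have "column_det n (L(j := hs)) = det (M hs)"
      by (simp add: column_det_def M_def)
    also have "\<dots> = (\<Sum>i<n. M hs $$ (i, j) * cofactor (M hs) i j)"
      using j by (intro laplace_expansion_column) (auto simp: M_def)
    also have "\<dots> = (\<Sum>i<n. column hs (Suc i) * cofactor (M []) i j)"
      using j cof[where hs = hs] by (intro sum.cong) (auto simp: M_def)
    finally show ?thesis .
  qed
  show ?thesis
    unfolding expand by (simp add: sum_subtractf sum_distrib_left algebra_simps)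
qed

definition pure_part :: "((nat \<Rightarrow> var) \<times> cpoly) list \<Rightarrow> ((nat \<Rightarrow> var) \<times> cpoly) list" where
  "pure_part fs = map (\<lambda>(v, c). (v, 0)) fs"

text \<open>The constants are set to $0$ one at a time; each step costs an element of $I_{<d}$, because the
  correction term in \<open>column_det_split_factor\<close> has lost a factor.\<close>

lemma column_det_cong_pure_part:
  assumes "\<And>j. j < n \<Longrightarrow> admissible n (L j)" and "d = (\<Sum>j<n. length (L j))"
  shows "column_det n L - column_det n (\<lambda>j. pure_part (L j)) \<in> diag_ideal_below n d"
  using assms
proof (induction "\<Sum>j<n. length (filter (\<lambda>(v, c). c \<noteq> 0) (L j))" arbitrary: L rule: less_induct)
  case less
  note ideal = ideal_diag_ideal_below[of n d]
  show ?case
  proof (cases "\<exists>j<n. \<exists>(v, c)\<in>set (L j). c \<noteq> 0")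
    case False
    have "pure_part (L j) = L j" if "j < n" for j
      unfolding pure_part_def using False that by (intro map_idI) auto
    then have "column_det n L = column_det n (\<lambda>j. pure_part (L j))"
      unfolding column_det_def by (intro arg_cong[of _ _ det] eq_matI) auto
    then show ?thesis using poly_ideal_zero[OF ideal] by simp
  next
    case True
    then obtain j v c where j: "j < n" and vc: "(v, c) \<in> set (L j)" and c: "c \<noteq> 0" by blast
    then obtain fs gs where Lj: "L j = fs @ (v, c) # gs" by (auto dest: split_list)
    define L0 where "L0 = L(j := fs @ (v, 0) # gs)"
    define L1 where "L1 = L(j := fs @ gs)"
    have "admissible n (L j)" using less.prems(1)[OF j] .
    then have adm: "admissible n (fs @ (v, 0) # gs)" "admissible n (fs @ gs)"
      and c_closed: "c \<in> carrier (poly_ring n)"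
      using poly_ring.zero_closed[of n] by (auto simp: Lj)
    have sums: "(\<Sum>k<n. g ((L(j := hs)) k)) = g hs + (\<Sum>k\<in>{..<n} - {j}. g (L k))"
      for g :: "_ \<Rightarrow> nat" and hs
      using j by (subst sum.remove[of "{..<n}" j]) (auto intro!: sum.cong)
    have sumsL: "(\<Sum>k<n. g (L k)) = g (L j) + (\<Sum>k\<in>{..<n} - {j}. g (L k))"
      for g :: "_ \<Rightarrow> nat"
      using j by (subst sum.remove[of "{..<n}" j]) auto
    have "column_det n L0 - column_det n (\<lambda>k. pure_part (L0 k)) \<in> diag_ideal_below n d"
    proof (rule less.hyps)
      show "(\<Sum>k<n. length (filter (\<lambda>(v, c). c \<noteq> 0) (L0 k)))
          < (\<Sum>k<n. length (filter (\<lambda>(v, c). c \<noteq> 0) (L k)))"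
        unfolding L0_def sums[of "\<lambda>fs. length (filter _ fs)"]
          sumsL[of "\<lambda>fs. length (filter _ fs)"] Lj using c by simp
      show "admissible n (L0 k)" if "k < n" for k
        using that adm(1) less.prems(1) by (simp add: L0_def)
      show "d = (\<Sum>k<n. length (L0 k))"
        unfolding less.prems(2) L0_def sums[of length] sumsL[of length] Lj by simp
    qed
    moreover have "column_det n L - column_det n (\<lambda>k. pure_part (L k))
        = column_det n L0 - column_det n (\<lambda>k. pure_part (L0 k)) - c * column_det n L1"
    proof -
      have "(\<lambda>k. pure_part (L0 k)) = (\<lambda>k. pure_part (L k))"
        by (auto simp: L0_def pure_part_def Lj)
      moreover have "column_det n L = column_det n L0 - c * column_det n L1"
        using column_det_split_factor[OF j, of L fs v c gs] Lj
        by (simp add: L0_def L1_def fun_upd_idem)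
      ultimately show ?thesis by (simp add: algebra_simps)
    qed
    moreover have "c * column_det n L1 \<in> diag_ideal_below n d"
    proof -
      have L1: "admissible n (L1 k)" if "k < n" for k
        using that adm(2) less.prems(1) by (simp add: L1_def)
      have "column_det n L1 \<in> diag_ideal n"
        using L1 by (rule column_det_in_diag_ideal)
      moreover have "homogeneous (\<Sum>k<n. length (L1 k)) (column_det n L1)"
        using L1 by (rule homogeneous_column_det)
      moreover have "(\<Sum>k<n. length (L1 k)) < d"
        unfolding less.prems(2) L1_def sums[of length] sumsL[of length] Lj by simp
      ultimately have "column_det n L1 \<in> diag_ideal_below n d"
        by (rule diag_ideal_belowI)
      then show ?thesis by (rule poly_ideal_mult[OF ideal _ c_closed])
    qed
    ultimately show ?thesis
      by (simp only: poly_ideal_diff[OF ideal])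
  qed
qed

section \<open>Block-triangular determinants and block interchanges\<close>

text \<open>The total rank is invariant under \<open>\<pi>\<close>, so no rank can drop without another one rising.\<close>

lemma rank_preserving:
  fixes r :: "nat \<Rightarrow> nat"
  assumes "\<pi> permutes S" "finite S" "\<And>i. i \<in> S \<Longrightarrow> r (\<pi> i) \<le> r i" "i \<in> S"
  shows "r (\<pi> i) = r i"
proof (rule sum_mono_inv[of "\<lambda>i. r (\<pi> i)" S r])
  show "(\<Sum>i\<in>S. r (\<pi> i)) = sum r S"
    using sum.permute[OF assms(1), of r] by (simp add: comp_def)
qed (use assms in auto)

text \<open>Two matrices that are block-triangular for the same partition of the indices into blocks, but
  for different orders of the blocks, have only the block-preserving permutations in their Leibniz
  expansions. So their determinants depend only on the diagonal blocks, which here differ by row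
  factors \<open>e\<close> and \<open>e'\<close> from a common \<open>N\<close>. Comparing the expansions term by term takes the place of
  factoring both determinants into their diagonal blocks.\<close>

lemma det_block_exchange:
  fixes M M' N :: "nat \<Rightarrow> nat \<Rightarrow> 'a :: comm_ring_1" and r r' :: "nat \<Rightarrow> nat"
  assumes tri: "\<And>i j. \<lbrakk>i < n; j < n; r i < r j\<rbrakk> \<Longrightarrow> M i j = 0"
    and tri': "\<And>i j. \<lbrakk>i < n; j < n; r' i < r' j\<rbrakk> \<Longrightarrow> M' i j = 0"
    and same: "\<And>i j. \<lbrakk>i < n; j < n\<rbrakk> \<Longrightarrow> r i = r j \<longleftrightarrow> r' i = r' j"
    and diag: "\<And>i j. \<lbrakk>i < n; j < n; r i = r j\<rbrakk> \<Longrightarrow> M i j = e i * N i j"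
    and diag': "\<And>i j. \<lbrakk>i < n; j < n; r i = r j\<rbrakk> \<Longrightarrow> M' i j = e' i * N i j"
    and ratio: "(\<Prod>i = 0..<n. e' i) = c * (\<Prod>i = 0..<n. e i)"
  shows "det (mat n n (\<lambda>(i, j). M' i j)) = c * det (mat n n (\<lambda>(i, j). M i j))"
proof -
  have vanish: "(\<Prod>i = 0..<n. A i (\<pi> i)) = 0"
    if A: "\<And>i j. \<lbrakk>i < n; j < n; s i < s j\<rbrakk> \<Longrightarrow> A i j = 0" and \<pi>: "\<pi> permutes {0..<n}"
      and i: "i < n" "s (\<pi> i) \<noteq> s i" for A :: "nat \<Rightarrow> nat \<Rightarrow> 'a" and s :: "nat \<Rightarrow> nat" and \<pi> i
  proof -
    obtain k where k: "k < n" "s k < s (\<pi> k)"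
      using rank_preserving[OF \<pi>, of s i] i by (force simp: not_less[symmetric])
    then have "A k (\<pi> k) = 0"
      using A permutes_in_image[OF \<pi>, of k] by auto
    then show ?thesis using k(1) by (intro prod_zero) auto
  qed
  have terms: "(\<Prod>i = 0..<n. M' i (\<pi> i)) = c * (\<Prod>i = 0..<n. M i (\<pi> i))"
    if \<pi>: "\<pi> permutes {0..<n}" for \<pi>
  proof (cases "\<forall>i<n. r (\<pi> i) = r i")
    case True
    have \<pi>n: "\<pi> i < n" if "i < n" for i using permutes_in_image[OF \<pi>, of i] that by simp
    have "(\<Prod>i = 0..<n. M' i (\<pi> i)) = (\<Prod>i = 0..<n. e' i * N i (\<pi> i))"
      using True \<pi>n by (intro prod.cong diag') auto
    moreover have "(\<Prod>i = 0..<n. M i (\<pi> i)) = (\<Prod>i = 0..<n. e i * N i (\<pi> i))"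
      using True \<pi>n by (intro prod.cong diag) auto
    ultimately show ?thesis by (simp add: prod.distrib ratio mult.assoc)
  next
    case False
    then obtain i where i: "i < n" "r (\<pi> i) \<noteq> r i" by blast
    then have "r' (\<pi> i) \<noteq> r' i"
      using same[of "\<pi> i" i] permutes_in_image[OF \<pi>, of i] by auto
    then show ?thesis
      using vanish[of r M, OF tri \<pi> i] vanish[of r' M', OF tri' \<pi> i(1)] by simp
  qed
  have leibniz: "det (mat n n (\<lambda>(i, j). A i j))
      = (\<Sum>\<pi> | \<pi> permutes {0..<n}. signof \<pi> * (\<Prod>i = 0..<n. A i (\<pi> i)))"
    for A :: "nat \<Rightarrow> nat \<Rightarrow> 'a"
  proof -
    have "\<pi> i < n" if "\<pi> permutes {0..<n}" "i < n" for \<pi> i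
      using permutes_in_image[OF that(1), of i] that(2) by simp
    then show ?thesis
      by (subst det_def'[of _ n]) (auto intro!: sum.cong prod.cong)
  qed
  show ?thesis
    unfolding leibniz by (auto simp: terms sum_distrib_left mult.left_commute intro!: sum.cong)
qed

lemma Delta_swap_initial:
  "Delta (xs @ ys @ zs) = (- 1) ^ (length xs * length ys) * Delta (ys @ xs @ zs)"
proof -
  let ?n = "length xs + (length ys + length zs)"
  define A where "A us = mat ?n ?n
     (\<lambda>(i, j). x_var (Suc i) ^ fst ((us :: (nat \<times> nat) list) ! j) * y_var (Suc i) ^ snd (us ! j))" for us
  have "mat ?n ?n (\<lambda>(i, j). A (xs @ ys @ zs) $$
      (i, if j < length ys then j + length xs
          else if j < length xs + length ys then j - length ys else j)) = A (ys @ xs @ zs)"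
    by (rule eq_matI) (auto simp: A_def nth_append add.commute)
  moreover have "Delta (xs @ ys @ zs) = det (A (xs @ ys @ zs))"
    by (simp add: Delta_def A_def)
  moreover have "Delta (ys @ xs @ zs) = det (A (ys @ xs @ zs))"
    by (simp add: Delta_def A_def ac_simps)
  ultimately show ?thesis
    using det_swap_initial_cols[of "A (xs @ ys @ zs)" ?n "length xs" "length ys"]
    by (simp add: A_def)
qed

text \<open>Moving \<open>zs\<close> to the front past \<open>xs @ ys\<close> and then bringing \<open>xs\<close> back before it costs
  \<open>length xs * length zs\<close> transpositions twice, so only \<open>length ys * length zs\<close> counts for the sign.\<close>

lemma Delta_swap_blocks:
  "Delta (xs @ ys @ zs @ ws) = (- 1) ^ (length ys * length zs) * Delta (xs @ zs @ ys @ ws)"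
proof -
  let ?x = "length xs" and ?y = "length ys" and ?z = "length zs"
  have "Delta (xs @ ys @ zs @ ws)
      = (- 1) ^ ((?x + ?y) * ?z) * ((- 1) ^ (?z * ?x) * Delta (xs @ zs @ ys @ ws))"
    using Delta_swap_initial[of "xs @ ys" zs ws] Delta_swap_initial[of zs xs "ys @ ws"] by simp
  also have "\<dots> = (- 1) ^ ((?x + ?y) * ?z + ?z * ?x) * Delta (xs @ zs @ ys @ ws)"
    by (simp only: power_add mult.assoc)
  also have "(?x + ?y) * ?z + ?z * ?x = ?y * ?z + 2 * (?z * ?x)"
    by (simp add: algebra_simps mult_2)
  also have "(- 1) ^ (?y * ?z + 2 * (?z * ?x)) = ((- 1) ^ (?y * ?z) :: cpoly)"
    by (simp add: power_add power_mult)
  finally show ?thesis .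
qed

section \<open>Columns with prescribed leading monomial and zeros\<close>

text \<open>The monomial $x^\alpha y^\beta$ with $P = (\alpha, \beta)$ is the top-degree part, in the
  coordinates of the row, of the product of the factors in \<open>fs\<close>.\<close>

definition lifts :: "nat \<Rightarrow> ((nat \<Rightarrow> var) \<times> cpoly) list \<Rightarrow> nat \<times> nat \<Rightarrow> bool" where
  "lifts n fs P \<longleftrightarrow> admissible n fs \<and> length fs = fst P + snd P \<and>
     (\<forall>p. column (pure_part fs) p = x_var p ^ fst P * y_var p ^ snd P)"

text \<open>Modulo polynomials of $I$ of smaller degree, $\Delta(D)$ does not depend on the constants in the
  linear factors that lift its monomials.\<close>

lemma column_det_cong_Delta:
  assumes lifts: "\<And>j. j < n \<Longrightarrow> lifts n (L j) (D ! j)" and n: "length D = n"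
    and d: "d = (\<Sum>j<n. fst (D ! j) + snd (D ! j))"
  shows "column_det n L - Delta D \<in> diag_ideal_below n d"
proof -
  have "column_det n (\<lambda>j. pure_part (L j)) = Delta D"
    unfolding column_det_def Delta_def n using lifts
    by (intro arg_cong[of _ _ det] eq_matI) (auto simp: lifts_def)
  moreover have "d = (\<Sum>j<n. length (L j))"
    unfolding d using lifts by (intro sum.cong) (auto simp: lifts_def)
  ultimately show ?thesis
    using column_det_cong_pure_part[of n L d] lifts by (simp add: lifts_def)
qed

definition roots_x :: "nat list \<Rightarrow> ((nat \<Rightarrow> var) \<times> cpoly) list" where
  "roots_x qs = map (\<lambda>q. (X, x_var (Suc q))) qs"

lemma column_roots_x:
  "distinct qs \<Longrightarrow> column (roots_x qs) p = (\<Prod>q\<in>set qs. x_var p - x_var (Suc q))"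
  by (induction qs) (auto simp: roots_x_def)

lemma column_roots_x_eq_0: "q \<in> set qs \<Longrightarrow> column (roots_x qs) (Suc q) = 0"
  by (rule column_eq_0[of X "x_var (Suc q)"]) (auto simp: roots_x_def)

lemma lifts_roots_x:
  assumes "set qs \<subseteq> {..<n}" "lifts n fs (a, b)"
  shows "lifts n (roots_x qs @ fs) (length qs + a, b)"
proof -
  have "column (pure_part (roots_x qs)) p = x_var p ^ length qs" for p
    by (induction qs) (auto simp: roots_x_def pure_part_def)
  moreover have "admissible n (roots_x qs)"
    using assms(1) homogeneous_var_poly
    by (auto simp: admissible_def roots_x_def intro!: x_var_closed)
  ultimately show ?thesis
    using assms(2) by (auto simp: lifts_def roots_x_def pure_part_def power_add mult.assoc)
qed

text \<open>A lift of $x^a y^b$ that vanishes at the first $k$ points, provided that it has at least $k$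
  factors: factor number $i < k$ vanishes at the point number $i$ through its $x$- or its
  $y$-coordinate, according to whether $i < a$.\<close>

definition through :: "nat \<Rightarrow> nat \<Rightarrow> nat \<Rightarrow> ((nat \<Rightarrow> var) \<times> cpoly) list" where
  "through k a b = map (\<lambda>i. (X, if i < k then x_var (Suc i) else 0)) [0..<a]
                 @ map (\<lambda>i. (Y, if i < k then y_var (Suc i) else 0)) [a..<a + b]"

lemma column_through_eq_0:
  assumes "i < k" "k \<le> a + b"
  shows "column (through k a b) (Suc i) = 0"
proof (cases "i < a")
  case True
  then have "(X, x_var (Suc i)) \<in> set (through k a b)"
    using assms by (force simp: through_def)
  then show ?thesis by (rule column_eq_0) simp
next
  case False
  then have "(Y, y_var (Suc i)) \<in> set (through k a b)"
    using assms by (force simp: through_def)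
  then show ?thesis by (rule column_eq_0) simp
qed

lemma lifts_through:
  assumes "k \<le> n"
  shows "lifts n (through k a b) (a, b)"
proof -
  have "column (map (\<lambda>i. (v, 0)) is) p = var_poly (v p) ^ length is"
    for v :: "nat \<Rightarrow> var" and "is" :: "nat list" and p
    by (induction "is") auto
  then have "column (pure_part (through k a b)) p = x_var p ^ a * y_var p ^ b" for p
    by (simp add: pure_part_def through_def comp_def)
  moreover have "admissible n (through k a b)"
    using assms homogeneous_var_poly poly_ring.zero_closed[of n]
    by (auto simp: admissible_def through_def intro!: x_var_closed y_var_closed)
  ultimately show ?thesis by (simp add: lifts_def through_def)
qed

lemma prod_diff_swap:
  fixes x :: "'b \<Rightarrow> 'a :: comm_ring_1"
  shows "(\<Prod>p\<in>A. \<Prod>q\<in>B. x p - x q) = (- 1) ^ (card A * card B) * (\<Prod>q\<in>B. \<Prod>p\<in>A. x q - x p)"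
proof -
  have "(\<Prod>p\<in>A. \<Prod>q\<in>B. x p - x q) = (\<Prod>p\<in>A. \<Prod>q\<in>B. (- 1) * (x q - x p))"
    by simp
  also have "\<dots> = (- 1) ^ (card A * card B) * (\<Prod>p\<in>A. \<Prod>q\<in>B. x q - x p)"
    unfolding prod.distrib by (simp add: mult.commute[of "card A"] flip: power_mult)
  also have "(\<Prod>p\<in>A. \<Prod>q\<in>B. x q - x p) = (\<Prod>q\<in>B. \<Prod>p\<in>A. x q - x p)"
    by (rule prod.swap)
  finally show ?thesis .
qed

section \<open>The interchange of two blocks of points\<close>

theorem lemma24:
  fixes n d h l m :: nat and \<alpha> \<beta> s :: "nat \<Rightarrow> nat" and D D' :: "(nat \<times> nat) list"
  assumes distinct_points: "inj_on (\<lambda>i. (\<alpha> i, \<beta> i)) {1..n}"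
    and s_def: "\<And>i. i \<in> {1..n} \<Longrightarrow> s i = \<alpha> i + \<beta> i"
    and s_mono: "mono_on {1..n} s"
    and s_last: "s (n + 1) = n"
    and d_def: "d = (\<Sum>i = 1..n. s i)"
    and pos: "0 < l" "0 < m"
    and range: "2 \<le> h" "h + l + m \<le> n + 1"
    and s_h: "s h = h - 1"
    and s_hl: "s (h + l) = h + l - 1"
    and s_hlm: "s (h + l + m) = h + l + m - 1"
    and \<alpha>_ge: "\<And>i. i \<in> {h + l..h + l + m - 1} \<Longrightarrow> l \<le> \<alpha> i"
    and D_def: "D = map (\<lambda>i. (\<alpha> i, \<beta> i)) [1..<n + 1]"
    and D'_def: "D' = map (\<lambda>i. (\<alpha> i, \<beta> i)) [1..<h]
                    @ map (\<lambda>i. (\<alpha> i - l, \<beta> i)) [h + l..<h + l + m]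
                    @ map (\<lambda>i. (\<alpha> i + m, \<beta> i)) [h..<h + l]
                    @ map (\<lambda>i. (\<alpha> i, \<beta> i)) [h + l + m..<n + 1]"
  shows "Delta D - Delta D' \<in> diag_ideal_below n d"
proof -
  note ideal = ideal_diag_ideal_below[of n d]
  define a where "a = h - 1"
  have h: "h = Suc a" and n: "a + l + m \<le> n" using range by (auto simp: a_def)
  let ?B = "{a..<a + l}" and ?C = "{a + l..<a + l + m}"
  define \<epsilon> :: cpoly where "\<epsilon> = (- 1) ^ (l * m)"
  have \<epsilon>2: "\<epsilon> * \<epsilon> = 1"
    by (simp add: \<epsilon>_def flip: power_mult_distrib)

  have s_eq: "s (Suc j) = \<alpha> (Suc j) + \<beta> (Suc j)" if "j < n" for j
    using that by (intro s_def) auto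
  have s_le: "s i \<le> s j" if "i \<in> {1..n}" "j \<in> {1..n}" "i \<le> j" for i j
    using mono_onD[OF s_mono that] .
  have deg_B: "a \<le> \<alpha> (Suc j) + \<beta> (Suc j)" if "j \<in> ?B" for j
    using s_le[of h "Suc j"] s_eq[of j] s_h that n by (auto simp: h)
  have deg_C: "a + l \<le> \<alpha> (Suc j) + \<beta> (Suc j)" if "j \<in> ?C" for j
    using s_le[of "h + l" "Suc j"] s_eq[of j] s_hl that n by (auto simp: h)
  have deg_T: "a + l + m \<le> \<alpha> (Suc j) + \<beta> (Suc j)" if "a + l + m \<le> j" "j < n" for j
    using s_le[of "h + l + m" "Suc j"] s_eq[of j] s_hlm that n by (auto simp: h)
  have \<alpha>_C: "l \<le> \<alpha> (Suc j)" if "j \<in> ?C" for j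
    using \<alpha>_ge[of "Suc j"] that by (auto simp: h)

  have d: "d = (\<Sum>j<n. s (Suc j))"
    by (simp add: d_def sum.atLeast1_atMost_eq)

  \<comment> \<open>The lifts for \<open>D\<close> and \<open>E\<close> have the common part \<open>K\<close>. It vanishes on the head rows for all later
    columns and on all three first blocks of rows for the tail columns. The other factors are the
    ones that make the columns \<open>C\<close> vanish on the rows \<open>B\<close> for \<open>D\<close>, and the columns \<open>B\<close> on the rows
    \<open>C\<close> for \<open>E\<close>. Rows and columns count from
    $0$, so the head block is \<open>{0..<a}\<close>.\<close>
  define K where "K j =
    (if j < a then through 0 (\<alpha> (Suc j)) (\<beta> (Suc j))
     else if j \<in> ?B then through a (\<alpha> (Suc j)) (\<beta> (Suc j))
     else if j \<in> ?C then through a (\<alpha> (Suc j) - l) (\<beta> (Suc j))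
     else through (a + l + m) (\<alpha> (Suc j)) (\<beta> (Suc j)))" for j
  define L where "L j = (if j \<in> ?C then roots_x [a..<a + l] else []) @ K j" for j
  define L' where "L' j = (if j \<in> ?B then roots_x [a + l..<a + l + m] else []) @ K j" for j
  define E where "E = map (\<lambda>i. (\<alpha> i, \<beta> i)) [1..<h]
                    @ map (\<lambda>i. (\<alpha> i + m, \<beta> i)) [h..<h + l]
                    @ map (\<lambda>i. (\<alpha> i - l, \<beta> i)) [h + l..<h + l + m]
                    @ map (\<lambda>i. (\<alpha> i, \<beta> i)) [h + l + m..<n + 1]"

  have D': "Delta D' = \<epsilon> * Delta E"
    unfolding D'_def E_def \<epsilon>_def by (subst Delta_swap_blocks) (simp add: mult.commute)

  have L: "column_det n L - Delta D \<in> diag_ideal_below n d"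
  proof (rule column_det_cong_Delta)
    show "length D = n" by (simp add: D_def)
    have D_nth: "D ! j = (\<alpha> (Suc j), \<beta> (Suc j))" if "j < n" for j
      using that by (simp add: D_def del: upt_Suc)
    show "lifts n (L j) (D ! j)" if "j < n" for j
    proof (cases "j \<in> ?C")
      case True
      then show ?thesis
        using lifts_roots_x[of "[a..<a + l]" n "K j" "\<alpha> (Suc j) - l" "\<beta> (Suc j)"] n \<alpha>_C[OF True]
        by (fastforce simp: D_nth[OF that] L_def K_def lifts_through)
    next
      case False
      then show ?thesis
        using n by (auto simp: D_nth[OF that] L_def K_def lifts_through)
    qed
    show "d = (\<Sum>j<n. fst (D ! j) + snd (D ! j))"
      unfolding d using D_nth s_eq by simp
  qed

  have L': "column_det n L' - Delta E \<in> diag_ideal_below n d"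
  proof (rule column_det_cong_Delta)
    show "length E = n" using n by (simp add: E_def h del: upt_Suc)
    have E_nth: "E ! j = (if j \<in> ?B then \<alpha> (Suc j) + m else if j \<in> ?C then \<alpha> (Suc j) - l
                          else \<alpha> (Suc j), \<beta> (Suc j))" if "j < n" for j
      using that n by (auto simp: E_def h nth_append simp del: upt_Suc)
    show "lifts n (L' j) (E ! j)" if "j < n" for j
    proof (cases "j \<in> ?B")
      case True
      then show ?thesis
        using lifts_roots_x[of "[a + l..<a + l + m]" n "K j" "\<alpha> (Suc j)" "\<beta> (Suc j)"] n
        by (fastforce simp: E_nth[OF that] L'_def K_def lifts_through add.commute)
    next
      case False
      then show ?thesis
        using n by (auto simp: E_nth[OF that] L'_def K_def lifts_through)
    qed
    \<comment> \<open>Raising the \<open>l\<close> points of \<open>B\<close> by \<open>m\<close> compensates for lowering the \<open>m\<close> points of \<open>C\<close> by \<open>l\<close>.\<close>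
    have "(\<Sum>j<n. fst (E ! j) + snd (E ! j) + (if j \<in> ?C then l else 0))
        = (\<Sum>j<n. s (Suc j) + (if j \<in> ?B then m else 0))"
      using E_nth s_eq \<alpha>_C by (intro sum.cong) auto
    moreover have "(\<Sum>j<n. if j \<in> ?C then l else 0) = (\<Sum>j<n. if j \<in> ?B then m else 0)"
    proof -
      have "{..<n} \<inter> ?C = ?C" "{..<n} \<inter> ?B = ?B" using n by auto
      then show ?thesis
        by (simp del: atLeastLessThan_iff flip: sum.inter_restrict)
    qed
    ultimately show "d = (\<Sum>j<n. fst (E ! j) + snd (E ! j))"
      unfolding d by (simp only: sum.distrib)
  qed

  have exchange: "column_det n L' = \<epsilon> * column_det n L"
  proof -
    \<comment> \<open>The ranks order the blocks as head, \<open>B\<close>, \<open>C\<close>, tail for \<open>D\<close> and as head, \<open>C\<close>, \<open>B\<close>, tail for \<open>E\<close>.\<close>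
    define r where "r j = (if j < a then 0 else if j \<in> ?B then 1 else if j \<in> ?C then 2 else 3 :: nat)" for j
    define r' where "r' j = (if j < a then 0 else if j \<in> ?C then 1 else if j \<in> ?B then 2 else 3 :: nat)" for j
    define e where "e i = (if i \<in> ?C then column (roots_x [a..<a + l]) (Suc i) else 1)" for i
    define e' where "e' i = (if i \<in> ?B then column (roots_x [a + l..<a + l + m]) (Suc i) else 1)" for i
    have K_head: "column (K j) (Suc i) = 0" if "i < a" "a \<le> j" "j < n" for i j
      using that deg_B[of j] deg_C[of j] \<alpha>_C[of j] deg_T[of j]
      by (auto simp: K_def intro!: column_through_eq_0)
    have K_tail: "column (K j) (Suc i) = 0" if "i < a + l + m" "a + l + m \<le> j" "j < n" for i j
      using that deg_T[of j] by (auto simp: K_def intro!: column_through_eq_0)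
    show ?thesis
      unfolding column_det_def
    proof (rule det_block_exchange)
      show "column (L j) (Suc i) = 0" if "j < n" "r i < r j" for i j
      proof (cases "j \<in> ?C \<and> i \<in> ?B")
        case True
        then show ?thesis by (simp add: L_def column_roots_x_eq_0)
      next
        case False
        then show ?thesis
          using that K_head[of i j] K_tail[of i j] by (auto simp: L_def r_def split: if_splits)
      qed
      show "column (L' j) (Suc i) = 0" if "j < n" "r' i < r' j" for i j
      proof (cases "j \<in> ?B \<and> i \<in> ?C")
        case True
        then show ?thesis by (simp add: L'_def column_roots_x_eq_0)
      next
        case False
        then show ?thesis
          using that K_head[of i j] K_tail[of i j] by (auto simp: L'_def r'_def split: if_splits)
      qed
      show "r i = r j \<longleftrightarrow> r' i = r' j" for i j
        by (auto simp: r_def r'_def)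
      show "column (L j) (Suc i) = e i * column (K j) (Suc i)" if "r i = r j" for i j
        using that by (auto simp: r_def L_def e_def split: if_splits)
      show "column (L' j) (Suc i) = e' i * column (K j) (Suc i)" if "r i = r j" for i j
        using that by (auto simp: r_def L'_def e'_def split: if_splits)
      have "(\<Prod>i = 0..<n. e' i) = (\<Prod>i\<in>?B. \<Prod>q\<in>?C. x_var (Suc i) - x_var (Suc q))"
        using n by (intro prod.mono_neutral_cong_right) (auto simp: e'_def column_roots_x)
      moreover have "(\<Prod>i = 0..<n. e i) = (\<Prod>i\<in>?C. \<Prod>q\<in>?B. x_var (Suc i) - x_var (Suc q))"
        using n by (intro prod.mono_neutral_cong_right) (auto simp: e_def column_roots_x)
      ultimately show "(\<Prod>i = 0..<n. e' i) = \<epsilon> * (\<Prod>i = 0..<n. e i)"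
        using prod_diff_swap[of "\<lambda>i. x_var (Suc i)" ?C ?B] by (simp add: \<epsilon>_def)
    qed
  qed

  have "\<epsilon> \<in> carrier (poly_ring n)"
    using poly_ring.one_closed[of n] poly_ring_uminus_closed[of 1 n]
    by (cases "even (l * m)") (simp_all add: \<epsilon>_def)
  then have "\<epsilon> * (column_det n L' - Delta E) \<in> diag_ideal_below n d"
    by (rule poly_ideal_mult[OF ideal L'])
  moreover have "\<epsilon> * (column_det n L' - Delta E) - (column_det n L - Delta D) = Delta D - Delta D'"
    by (simp add: exchange D' right_diff_distrib \<epsilon>2 flip: mult.assoc)
  ultimately show ?thesis
    using poly_ideal_diff[OF ideal _ L] by metis
qed

end
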